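(* There exists an everywhere defined, non-closable, unbounded linear operator $T$ on some Hilbert space such that $T^2=I$, where $I$ is the identity operator on that space.
   Context: Hilbert spaces are complex. A linear operator $T$ on a Hilbert space $K$ is everywhere defined if $D(T)=K$. It is closable if, for every sequence $(x_k)$ in $D(T)$ with $x_k\to 0$ and $Tx_k\to y$, one has $y=0$; otherwise it is non-closable. *)

theory Defs
  imports Complex_Main "HOL-Algebra.Module"
begin

definition complex_field :: "complex ring" where
  "complex_field = \<lparr>carrier = UNIV, mult = (*), one = 1, zero = 0, add = (+)\<rparr>"

text \<open>
  The library has no complex inner product spaces.  We build them on the vector space structure
  given by the \<^locale>\<open>module\<close> locale over the field of complex numbers.  The record type
  \<open>module\<close> also carries the ring fields \<open>mult\<close> and \<open>one\<close>, which the locale does not constrain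
  and which are irrelevant here.
\<close>

record 'a cinner_space = "(complex, 'a) module" +
  cinner :: "'a \<Rightarrow> 'a \<Rightarrow> complex"

text \<open>The inner product is linear in the first argument and conjugate linear in the second.\<close>

locale complex_inner_product_space = Module.module complex_field H for H (structure) +
  assumes cinner_add_left:
      "\<lbrakk>x \<in> carrier H; y \<in> carrier H; z \<in> carrier H\<rbrakk> \<Longrightarrow>
        cinner H (x \<oplus>\<^bsub>H\<^esub> y) z = cinner H x z + cinner H y z"
    and cinner_smult_left:
      "\<lbrakk>x \<in> carrier H; y \<in> carrier H\<rbrakk> \<Longrightarrow> cinner H (a \<odot>\<^bsub>H\<^esub> x) y = a * cinner H x y"
    and cinner_commute:
      "\<lbrakk>x \<in> carrier H; y \<in> carrier H\<rbrakk> \<Longrightarrow> cinner H x y = cnj (cinner H y x)"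
    and cinner_ge_zero:
      "x \<in> carrier H \<Longrightarrow> cinner H x x \<in> \<real> \<and> 0 \<le> Re (cinner H x x)"
    and cinner_eq_zeroD:
      "\<lbrakk>x \<in> carrier H; cinner H x x = 0\<rbrakk> \<Longrightarrow> x = \<zero>\<^bsub>H\<^esub>"

definition hnorm :: "('a, 'b) cinner_space_scheme \<Rightarrow> 'a \<Rightarrow> real" where
  "hnorm H x = sqrt (Re (cinner H x x))"

definition hconverges :: "('a, 'b) cinner_space_scheme \<Rightarrow> (nat \<Rightarrow> 'a) \<Rightarrow> 'a \<Rightarrow> bool" where
  "hconverges H u x \<longleftrightarrow> (\<lambda>n. hnorm H (u n \<ominus>\<^bsub>H\<^esub> x)) \<longlonglongrightarrow> 0"

definition hCauchy :: "('a, 'b) cinner_space_scheme \<Rightarrow> (nat \<Rightarrow> 'a) \<Rightarrow> bool" where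
  "hCauchy H u \<longleftrightarrow> (\<forall>e>0. \<exists>N. \<forall>m\<ge>N. \<forall>n\<ge>N. hnorm H (u m \<ominus>\<^bsub>H\<^esub> u n) < e)"

locale complex_hilbert_space = complex_inner_product_space +
  assumes complete:
    "\<lbrakk>range u \<subseteq> carrier H; hCauchy H u\<rbrakk> \<Longrightarrow> \<exists>x\<in>carrier H. hconverges H u x"

text \<open>
  An operator on \<open>H\<close>, with a domain that may be a proper subspace, is a partial function: \<open>dom T\<close>
  is \<open>D(T)\<close>, and the value of \<open>T\<close> at \<open>x \<in> D(T)\<close> is \<open>the (T x)\<close>.  The product of two operators
  with its usual domain \<open>{x \<in> D(S). S x \<in> D(T)}\<close> is then \<open>T \<circ>\<^sub>m S\<close>, and equality of partial
  functions is equality of operators, domains included.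
\<close>

locale linear_operator = complex_hilbert_space H for H (structure) and T :: "'a \<rightharpoonup> 'a" +
  assumes dom_submodule: "submodule (dom T) complex_field H"
    and ran_subset: "ran T \<subseteq> carrier H"
    and op_add:
      "\<lbrakk>x \<in> dom T; y \<in> dom T\<rbrakk> \<Longrightarrow> the (T (x \<oplus>\<^bsub>H\<^esub> y)) = the (T x) \<oplus>\<^bsub>H\<^esub> the (T y)"
    and op_smult:
      "x \<in> dom T \<Longrightarrow> the (T (a \<odot>\<^bsub>H\<^esub> x)) = a \<odot>\<^bsub>H\<^esub> the (T x)"

definition identity_operator :: "('a, 'b) cinner_space_scheme \<Rightarrow> 'a \<rightharpoonup> 'a" where
  "identity_operator H = Some |` carrier H"

definition everywhere_defined :: "('a, 'b) cinner_space_scheme \<Rightarrow> ('a \<rightharpoonup> 'a) \<Rightarrow> bool" where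
  "everywhere_defined H T \<longleftrightarrow> dom T = carrier H"

definition bounded_operator :: "('a, 'b) cinner_space_scheme \<Rightarrow> ('a \<rightharpoonup> 'a) \<Rightarrow> bool" where
  "bounded_operator H T \<longleftrightarrow> (\<exists>M. \<forall>x\<in>dom T. hnorm H (the (T x)) \<le> M * hnorm H x)"

definition closable :: "('a, 'b) cinner_space_scheme \<Rightarrow> ('a \<rightharpoonup> 'a) \<Rightarrow> bool" where
  "closable H T \<longleftrightarrow>
    (\<forall>u. \<forall>y\<in>carrier H. range u \<subseteq> dom T \<and> hconverges H u \<zero>\<^bsub>H\<^esub> \<and>
      hconverges H (\<lambda>k. the (T (u k))) y \<longrightarrow> y = \<zero>\<^bsub>H\<^esub>)"

end

theory Submission
  imports Defs "HOL-Library.Function_Algebras"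
begin

text \<open>
  Let \<open>f\<close> be a linear functional on a Hilbert space and \<open>v\<close> a vector with \<open>f v = 1\<close>.  The
  reflection \<open>T x = x - 2 f(x) v\<close> fixes the kernel of \<open>f\<close> and negates \<open>v\<close>, so \<open>T\<^sup>2 = I\<close>, whether
  or not \<open>f\<close> is continuous.  If some sequence \<open>x\<^sub>k \<rightarrow> 0\<close> has \<open>f(x\<^sub>k) = 1\<close> for all \<open>k\<close>, then
  \<open>T x\<^sub>k = x\<^sub>k - 2 v \<rightarrow> - 2 v \<noteq> 0\<close>, so \<open>T\<close> is not closable.  An everywhere defined bounded
  operator is closable, so \<open>T\<close> is unbounded as well.

  The space is the space of square summable complex sequences.  Its unit vectors \<open>e\<^sub>k\<close> are linearly
  independent in the vector space of all sequences, so a Hamel basis argument (lemma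
  \<open>exists_functional_on_unit_seqs\<close>) gives a linear functional with \<open>f(e\<^sub>k) = k + 1\<close>.  Then \<open>v = e\<^sub>0\<close>
  and \<open>x\<^sub>k = e\<^sub>k / (k + 1)\<close> are as required.
\<close>

section \<open>The Hilbert space of square summable sequences\<close>

definition ell2 :: "(nat \<Rightarrow> complex) cinner_space" where
  "ell2 = \<lparr>carrier = {x. summable (\<lambda>i. (cmod (x i))\<^sup>2)}, mult = (*), one = 1,
    zero = 0, add = (+), smult = (\<lambda>a x i. a * x i),
    cinner = (\<lambda>x y. \<Sum>i. x i * cnj (y i))\<rparr>"

lemma ell2_simps [simp]:
  "x \<in> carrier ell2 \<longleftrightarrow> summable (\<lambda>i. (cmod (x i))\<^sup>2)"
  "\<zero>\<^bsub>ell2\<^esub> = 0"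
  "x \<oplus>\<^bsub>ell2\<^esub> y = x + y"
  "a \<odot>\<^bsub>ell2\<^esub> x = (\<lambda>i. a * x i)"
  "cinner ell2 x y = (\<Sum>i. x i * cnj (y i))"
  by (simp_all add: ell2_def)

lemma summable_square_norm_smult:
  fixes x :: "nat \<Rightarrow> complex"
  assumes "summable (\<lambda>i. (cmod (x i))\<^sup>2)"
  shows "summable (\<lambda>i. (cmod (a * x i))\<^sup>2)"
  using assms by (simp add: norm_mult power_mult_distrib summable_mult)

lemma summable_square_norm_add:
  fixes x y :: "nat \<Rightarrow> complex"
  assumes "summable (\<lambda>i. (cmod (x i))\<^sup>2)" and "summable (\<lambda>i. (cmod (y i))\<^sup>2)"
  shows "summable (\<lambda>i. (cmod (x i + y i))\<^sup>2)"
proof (rule summable_comparison_test')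
  show "summable (\<lambda>i. 2 * (cmod (x i))\<^sup>2 + 2 * (cmod (y i))\<^sup>2)"
    using assms by (intro summable_add summable_mult)
  fix i :: nat
  have "(cmod (x i + y i))\<^sup>2 \<le> (cmod (x i) + cmod (y i))\<^sup>2"
    by (intro power_mono norm_triangle_ineq) simp
  also have "\<dots> \<le> 2 * (cmod (x i))\<^sup>2 + 2 * (cmod (y i))\<^sup>2"
    using sum_squares_bound[of "cmod (x i)" "cmod (y i)"] by (simp add: power2_sum)
  finally show "norm ((cmod (x i + y i))\<^sup>2) \<le> 2 * (cmod (x i))\<^sup>2 + 2 * (cmod (y i))\<^sup>2"
    by simp
qed

lemma summable_square_norm_diff:
  fixes x y :: "nat \<Rightarrow> complex"
  assumes "summable (\<lambda>i. (cmod (x i))\<^sup>2)" and "summable (\<lambda>i. (cmod (y i))\<^sup>2)"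
  shows "summable (\<lambda>i. (cmod (x i - y i))\<^sup>2)"
  using summable_square_norm_add[OF assms(1) summable_square_norm_smult[OF assms(2), of "-1"]]
  by simp

text \<open>The arithmetic-geometric mean inequality makes the defining series of the inner product
  converge absolutely.\<close>

lemma summable_ell2_inner:
  fixes x y :: "nat \<Rightarrow> complex"
  assumes "summable (\<lambda>i. (cmod (x i))\<^sup>2)" and "summable (\<lambda>i. (cmod (y i))\<^sup>2)"
  shows "summable (\<lambda>i. x i * cnj (y i))"
proof (rule summable_comparison_test')
  show "summable (\<lambda>i. (cmod (x i))\<^sup>2 + (cmod (y i))\<^sup>2)"
    using assms by (rule summable_add)
  fix i :: nat
  have "2 * (cmod (x i) * cmod (y i)) \<le> (cmod (x i))\<^sup>2 + (cmod (y i))\<^sup>2"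
    using sum_squares_bound[of "cmod (x i)" "cmod (y i)"] by simp
  moreover have "0 \<le> cmod (x i) * cmod (y i)"
    by simp
  ultimately have "cmod (x i) * cmod (y i) \<le> (cmod (x i))\<^sup>2 + (cmod (y i))\<^sup>2"
    by linarith
  then show "norm (x i * cnj (y i)) \<le> (cmod (x i))\<^sup>2 + (cmod (y i))\<^sup>2"
    by (simp add: norm_mult)
qed

lemma ell2_inner_self:
  assumes "x \<in> carrier ell2"
  shows "cinner ell2 x x = complex_of_real (\<Sum>i. (cmod (x i))\<^sup>2)"
  using assms by (simp add: suminf_of_real complex_norm_square del: of_real_power)

lemma hnorm_ell2:
  assumes "x \<in> carrier ell2"
  shows "hnorm ell2 x = sqrt (\<Sum>i. (cmod (x i))\<^sup>2)"
  unfolding hnorm_def ell2_inner_self[OF assms] by simp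

lemma sum_le_hnorm_ell2_square:
  assumes "x \<in> carrier ell2"
  shows "(\<Sum>i<K. (cmod (x i))\<^sup>2) \<le> (hnorm ell2 x)\<^sup>2"
  using assms sum_le_suminf[of "\<lambda>i. (cmod (x i))\<^sup>2" "{..<K}"]
  by (simp add: hnorm_ell2 suminf_nonneg)

lemma norm_coord_le_hnorm_ell2:
  assumes "x \<in> carrier ell2"
  shows "cmod (x i) \<le> hnorm ell2 x"
proof -
  have "(cmod (x i))\<^sup>2 \<le> (\<Sum>j<Suc i. (cmod (x j))\<^sup>2)"
    by (simp add: sum_nonneg)
  also have "\<dots> \<le> (hnorm ell2 x)\<^sup>2"
    using assms by (rule sum_le_hnorm_ell2_square)
  finally show ?thesis
  proof (rule power2_le_imp_le)
    show "0 \<le> hnorm ell2 x"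
      using assms by (simp add: hnorm_ell2 suminf_nonneg)
  qed
qed

lemma abelian_group_ell2: "abelian_group ell2"
proof (rule abelian_groupI)
  fix x assume "x \<in> carrier ell2"
  then show "\<exists>y\<in>carrier ell2. y \<oplus>\<^bsub>ell2\<^esub> x = \<zero>\<^bsub>ell2\<^esub>"
    by (intro bexI[of _ "- x"]) auto
qed (auto simp: summable_square_norm_add add.assoc add.commute)

lemma minus_ell2 [simp]:
  assumes "summable (\<lambda>i. (cmod (x i))\<^sup>2)" and "summable (\<lambda>i. (cmod (y i))\<^sup>2)"
  shows "x \<ominus>\<^bsub>ell2\<^esub> y = x - y"
proof -
  interpret abelian_group ell2
    by (rule abelian_group_ell2)
  have "\<ominus>\<^bsub>ell2\<^esub> y = - y"
    using assms by (intro minus_equality) auto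
  then show ?thesis
    by (simp add: a_minus_def)
qed

lemma cring_complex_field: "cring complex_field"
proof (rule cringI)
  show "abelian_group complex_field"
  proof (rule abelian_groupI)
    fix x assume "x \<in> carrier complex_field"
    show "\<exists>y\<in>carrier complex_field. y \<oplus>\<^bsub>complex_field\<^esub> x = \<zero>\<^bsub>complex_field\<^esub>"
      by (intro bexI[of _ "- x"]) (auto simp: complex_field_def)
  qed (auto simp: complex_field_def)
  show "comm_monoid complex_field"
    by (rule comm_monoidI) (auto simp: complex_field_def)
qed (auto simp: complex_field_def algebra_simps)

lemma module_ell2: "Module.module complex_field ell2"
  by (rule moduleI[OF cring_complex_field abelian_group_ell2])
    (auto simp: complex_field_def summable_square_norm_smult fun_eq_iff algebra_simps)

lemma complex_inner_product_space_ell2: "complex_inner_product_space ell2"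
proof (intro complex_inner_product_space.intro complex_inner_product_space_axioms.intro module_ell2)
  fix x y z assume xyz: "x \<in> carrier ell2" "y \<in> carrier ell2" "z \<in> carrier ell2"
  then show "cinner ell2 (x \<oplus>\<^bsub>ell2\<^esub> y) z = cinner ell2 x z + cinner ell2 y z"
    by (simp add: suminf_add summable_ell2_inner distrib_right)
next
  fix a x y assume "x \<in> carrier ell2" "y \<in> carrier ell2"
  then show "cinner ell2 (a \<odot>\<^bsub>ell2\<^esub> x) y = a * cinner ell2 x y"
    by (simp add: suminf_mult summable_ell2_inner mult.assoc)
next
  fix x y assume "x \<in> carrier ell2" "y \<in> carrier ell2"
  then have "(\<lambda>i. y i * cnj (x i)) sums cinner ell2 y x"
    by (simp add: summable_ell2_inner summable_sums)
  then have "(\<lambda>i. cnj (y i * cnj (x i))) sums cnj (cinner ell2 y x)"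
    by (simp only: sums_cnj)
  then show "cinner ell2 x y = cnj (cinner ell2 y x)"
    by (simp add: sums_iff mult.commute)
next
  fix x assume x: "x \<in> carrier ell2"
  then show "cinner ell2 x x \<in> \<real> \<and> 0 \<le> Re (cinner ell2 x x)"
    unfolding ell2_inner_self[OF x] by (simp add: suminf_nonneg)
  assume "cinner ell2 x x = 0"
  then show "x = \<zero>\<^bsub>ell2\<^esub>"
    using x unfolding ell2_inner_self[OF x] by (auto simp: suminf_eq_zero_iff fun_eq_iff)
qed

text \<open>
  Each coordinate of a Cauchy sequence is Cauchy, which yields a coordinatewise limit.  Passing to
  the limit in one argument of the Cauchy estimate, first for partial sums of the norm, shows
  that the limit is square summable and is approached in norm.
\<close>

lemma complex_hilbert_space_ell2: "complex_hilbert_space ell2"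
proof (intro complex_hilbert_space.intro complex_hilbert_space_axioms.intro
    complex_inner_product_space_ell2)
  fix u assume ran: "range u \<subseteq> carrier ell2" and cau: "hCauchy ell2 u"
  have u: "summable (\<lambda>i. (cmod (u n i))\<^sup>2)" for n
    using ran ell2_simps(1) by blast
  have diff: "u m - u n \<in> carrier ell2" for m n
    using summable_square_norm_diff[OF u u] by simp
  have cau': "\<exists>N. \<forall>m\<ge>N. \<forall>n\<ge>N. hnorm ell2 (u m - u n) < e" if "e > 0" for e
    using cau that unfolding hCauchy_def by (simp add: u)
  have "Cauchy (\<lambda>n. u n i)" for i
  proof (rule CauchyI)
    fix e :: real assume "e > 0"
    then obtain N where N: "\<forall>m\<ge>N. \<forall>n\<ge>N. hnorm ell2 (u m - u n) < e"
      using cau' by blast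
    have "cmod (u m i - u n i) < e" if "m \<ge> N" "n \<ge> N" for m n
      using norm_coord_le_hnorm_ell2[OF diff, of m n i] N that by fastforce
    then show "\<exists>N. \<forall>m\<ge>N. \<forall>n\<ge>N. cmod (u m i - u n i) < e"
      by blast
  qed
  then have "\<forall>i. \<exists>l. (\<lambda>n. u n i) \<longlonglongrightarrow> l"
    by (simp add: Cauchy_convergent_iff convergent_def)
  then obtain x where x: "\<And>i. (\<lambda>n. u n i) \<longlonglongrightarrow> x i"
    by metis
  have est: "\<exists>N. \<forall>m\<ge>N. summable (\<lambda>i. (cmod (u m i - x i))\<^sup>2) \<and> (\<Sum>i. (cmod (u m i - x i))\<^sup>2) \<le> e\<^sup>2"
    if e: "e > 0" for e :: real
  proof -
    obtain N where N: "\<forall>m\<ge>N. \<forall>n\<ge>N. hnorm ell2 (u m - u n) < e"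
      using cau' e by blast
    have partial: "(\<Sum>i<K. (cmod (u m i - x i))\<^sup>2) \<le> e\<^sup>2" if m: "m \<ge> N" for m K
    proof (rule tendsto_upperbound)
      show "(\<lambda>n. \<Sum>i<K. (cmod (u m i - u n i))\<^sup>2) \<longlonglongrightarrow> (\<Sum>i<K. (cmod (u m i - x i))\<^sup>2)"
        by (intro tendsto_intros x)
      have "(\<Sum>i<K. (cmod (u m i - u n i))\<^sup>2) \<le> e\<^sup>2" if n: "n \<ge> N" for n
      proof -
        have "(\<Sum>i<K. (cmod (u m i - u n i))\<^sup>2) \<le> (hnorm ell2 (u m - u n))\<^sup>2"
          using sum_le_hnorm_ell2_square[OF diff] by simp
        also have "\<dots> \<le> e\<^sup>2"
        proof (rule power_mono)
          show "hnorm ell2 (u m - u n) \<le> e"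
            using N m n by (blast intro: less_imp_le)
          show "0 \<le> hnorm ell2 (u m - u n)"
            using diff[of m n] by (simp add: hnorm_ell2 suminf_nonneg)
        qed
        finally show ?thesis .
      qed
      then show "\<forall>\<^sub>F n in sequentially. (\<Sum>i<K. (cmod (u m i - u n i))\<^sup>2) \<le> e\<^sup>2"
        by (auto simp: eventually_sequentially)
    qed simp
    show ?thesis
    proof (intro exI allI impI conjI)
      fix m assume m: "N \<le> m"
      show s: "summable (\<lambda>i. (cmod (u m i - x i))\<^sup>2)"
        using partial[OF m] by (intro bounded_imp_summable[where B = "e\<^sup>2"])
          (simp_all add: lessThan_Suc_atMost[symmetric] del: sum.lessThan_Suc)
      show "(\<Sum>i. (cmod (u m i - x i))\<^sup>2) \<le> e\<^sup>2"
        using s partial[OF m] by (intro suminf_le_const)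
    qed
  qed
  obtain N where "summable (\<lambda>i. (cmod (u N i - x i))\<^sup>2)"
    using est[of 1] by auto
  from summable_square_norm_diff[OF u[of N] this] have xc: "summable (\<lambda>i. (cmod (x i))\<^sup>2)"
    by simp
  have dx: "u n - x \<in> carrier ell2" for n
    using summable_square_norm_diff[OF u xc] by simp
  have "(\<lambda>n. hnorm ell2 (u n - x)) \<longlonglongrightarrow> 0"
  proof (rule LIMSEQ_I)
    fix e :: real assume e: "e > 0"
    then obtain N where N: "\<forall>m\<ge>N. (\<Sum>i. (cmod (u m i - x i))\<^sup>2) \<le> (e / 2)\<^sup>2"
      using est[of "e / 2"] by auto
    have "norm (hnorm ell2 (u m - x) - 0) < e" if "m \<ge> N" for m
    proof -
      have "hnorm ell2 (u m - x) \<le> e / 2"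
        unfolding hnorm_ell2[OF dx] using N that e by (intro real_le_lsqrt) auto
      moreover have "0 \<le> hnorm ell2 (u m - x)"
        using dx[of m] by (simp add: hnorm_ell2 suminf_nonneg)
      ultimately show ?thesis
        using e by simp
    qed
    then show "\<exists>N. \<forall>m\<ge>N. norm (hnorm ell2 (u m - x) - 0) < e"
      by blast
  qed
  then have "hconverges ell2 u x"
    by (simp add: hconverges_def u xc)
  then show "\<exists>x\<in>carrier ell2. hconverges ell2 u x"
    using xc by (intro bexI[of _ x]) simp_all
qed

lemma hconverges_ell2_coord:
  assumes "range u \<subseteq> carrier ell2" and "x \<in> carrier ell2" and "hconverges ell2 u x"
  shows "(\<lambda>n. u n i) \<longlonglongrightarrow> x i"
proof -
  have u: "summable (\<lambda>i. (cmod (u n i))\<^sup>2)" for n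
    using assms(1) ell2_simps(1) by blast
  have x: "summable (\<lambda>i. (cmod (x i))\<^sup>2)"
    using assms(2) by simp
  have "cmod (u n i - x i) \<le> hnorm ell2 (u n - x)" for n
    using norm_coord_le_hnorm_ell2[of "u n - x" i] summable_square_norm_diff[OF u x] by simp
  moreover have "(\<lambda>n. hnorm ell2 (u n - x)) \<longlonglongrightarrow> 0"
    using assms(3) by (simp add: hconverges_def u x)
  ultimately have "(\<lambda>n. u n i - x i) \<longlonglongrightarrow> 0"
    using tendsto_0_le[of "\<lambda>n. hnorm ell2 (u n - x)" sequentially "\<lambda>n. u n i - x i" 1]
    by (simp add: order_trans[OF _ abs_ge_self])
  then show ?thesis
    by (rule LIM_zero_cancel)
qed

text \<open>
  Boundedness forces \<open>T u\<^sub>k \<rightarrow> 0\<close> whenever \<open>u\<^sub>k \<rightarrow> 0\<close>.  Uniqueness of limits is read off coordinate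
  by coordinate.
\<close>

lemma bounded_imp_closable_ell2:
  assumes dom: "dom T \<subseteq> carrier ell2" and ran: "ran T \<subseteq> carrier ell2"
    and bounded: "bounded_operator ell2 T"
  shows "closable ell2 T"
  unfolding closable_def
proof (intro allI ballI impI; elim conjE)
  fix u y
  assume y: "y \<in> carrier ell2" and u: "range u \<subseteq> dom T"
    and u0: "hconverges ell2 u \<zero>\<^bsub>ell2\<^esub>" and Tu: "hconverges ell2 (\<lambda>k. the (T (u k))) y"
  obtain M where M: "\<And>x. x \<in> dom T \<Longrightarrow> hnorm ell2 (the (T x)) \<le> M * hnorm ell2 x"
    using bounded unfolding bounded_operator_def by blast
  have ud: "u k \<in> dom T" and uc: "u k \<in> carrier ell2" for k
    using u dom by blast+
  have Tuc: "the (T (u k)) \<in> carrier ell2" for k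
    using ud[of k] ran by (metis domD option.sel ranI subsetD)
  have lim: "(\<lambda>k. M * hnorm ell2 (u k)) \<longlonglongrightarrow> 0"
    using u0 uc tendsto_mult_right_zero[of "\<lambda>k. hnorm ell2 (u k)" sequentially M]
    by (simp add: hconverges_def)
  show "y = \<zero>\<^bsub>ell2\<^esub>"
  proof
    fix i
    have "cmod (the (T (u k)) i) \<le> M * hnorm ell2 (u k)" for k
      using norm_coord_le_hnorm_ell2[OF Tuc] M[OF ud] by (rule order_trans)
    then have "(\<lambda>k. the (T (u k)) i) \<longlonglongrightarrow> 0"
      by (intro tendsto_0_le[OF lim, of _ 1]) (auto intro!: always_eventually order_trans[OF _ abs_ge_self])
    moreover have "(\<lambda>k. the (T (u k)) i) \<longlonglongrightarrow> y i"
      using Tuc by (intro hconverges_ell2_coord[OF _ y Tu]) auto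
    ultimately show "y i = \<zero>\<^bsub>ell2\<^esub> i"
      using LIMSEQ_unique by fastforce
  qed
qed

section \<open>A discontinuous linear functional\<close>

definition unit_seq :: "nat \<Rightarrow> nat \<Rightarrow> complex" where
  "unit_seq n i = (if i = n then 1 else 0)"

lemma inj_unit_seq: "inj unit_seq"
  by (rule injI) (metis unit_seq_def zero_neq_one)

lemma sums_norm_square_unit_seq:
  "(\<lambda>i. (cmod (a * unit_seq n i))\<^sup>2) sums (cmod a)\<^sup>2"
  using sums_single[of n "\<lambda>_. (cmod a)\<^sup>2"]
  by (rule sums_cong[THEN iffD1, rotated]) (simp add: unit_seq_def)

lemma unit_seq_in_ell2: "unit_seq n \<in> carrier ell2"
  using sums_norm_square_unit_seq[of 1 n] by (simp add: sums_iff)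

lemma hnorm_scaled_unit_seq: "hnorm ell2 (\<lambda>i. a * unit_seq n i) = cmod a"
  using sums_norm_square_unit_seq[of a n] by (subst hnorm_ell2) (auto simp: sums_iff)

text \<open>
  The unit vectors are linearly independent, since a linear combination has the coefficient of
  \<open>e\<^sub>n\<close> as its entry at \<open>n\<close>; they extend to a Hamel basis, on which a linear functional can be
  prescribed at will.  All sequences are admitted, not only the square summable ones, because the
  extension theorem speaks of vector spaces that fill a whole type.
\<close>

lemma exists_functional_on_unit_seqs:
  fixes g :: "nat \<Rightarrow> complex"
  obtains f :: "(nat \<Rightarrow> complex) \<Rightarrow> complex"
  where "\<And>x y. f (x + y) = f x + f y" and "\<And>a x. f (\<lambda>i. a * x i) = a * f x"
    and "\<And>n. f (unit_seq n) = g n"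
proof -
  interpret vector_space_pair "\<lambda>(a::complex) (x::nat \<Rightarrow> complex) i. a * x i" "(*) :: complex \<Rightarrow> _"
    by unfold_locales (auto simp: algebra_simps fun_eq_iff)
  have "vs1.independent (range unit_seq)"
    unfolding vs1.independent_explicit_module
  proof (intro allI impI)
    fix t u and v :: "nat \<Rightarrow> complex"
    assume t: "finite t" "t \<subseteq> range unit_seq" and v: "v \<in> t"
      and zero: "(\<Sum>w\<in>t. (\<lambda>i. u w * w i)) = 0"
    obtain n where n: "v = unit_seq n"
      using t v by blast
    have apply_sum: "(\<Sum>w\<in>s. (\<lambda>i. u w * w i)) n = (\<Sum>w\<in>s. u w * w n)" if "finite s" for s
      using that by induction auto
    \<comment> \<open>Among the unit vectors, only \<open>v\<close> has a nonzero entry at \<open>n\<close>.\<close>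
    have "(\<Sum>w\<in>t. u w * w n) = (\<Sum>w\<in>t. if w = v then u v else 0)"
      using t(2) n by (intro sum.cong) (auto simp: unit_seq_def split: if_splits)
    with apply_sum[OF t(1)] zero show "u v = 0"
      using t(1) v by simp
  qed
  from linear_independent_extend[OF this, of "\<lambda>x. g (inv_into UNIV unit_seq x)"]
  obtain f where f: "Vector_Spaces.linear (\<lambda>(a::complex) (x::nat \<Rightarrow> complex) i. a * x i) (*) f"
    and fg: "\<forall>x\<in>range unit_seq. f x = g (inv_into UNIV unit_seq x)"
    by blast
  interpret f: Vector_Spaces.linear "\<lambda>(a::complex) (x::nat \<Rightarrow> complex) i. a * x i" "(*)" f
    by (rule f)
  show thesis
    by (rule that[of f]) (use fg f.add f.scale in \<open>auto simp: inj_unit_seq\<close>)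
qed

section \<open>Reflections along a linear functional\<close>

definition reflection ::
  "((nat \<Rightarrow> complex) \<Rightarrow> complex) \<Rightarrow> (nat \<Rightarrow> complex) \<Rightarrow> (nat \<Rightarrow> complex) \<rightharpoonup> (nat \<Rightarrow> complex)"
  where "reflection f v = (\<lambda>x. Some (\<lambda>i. x i - 2 * f x * v i)) |` carrier ell2"

lemma reflection_apply [simp]:
  "x \<in> carrier ell2 \<Longrightarrow> reflection f v x = Some (\<lambda>i. x i - 2 * f x * v i)"
  by (simp add: reflection_def)

lemma dom_reflection [simp]: "dom (reflection f v) = carrier ell2"
  by (auto simp: reflection_def dom_def restrict_map_def simp del: ell2_simps(1) split: if_splits)

lemma reflection_closed:
  assumes "x \<in> carrier ell2" and "v \<in> carrier ell2"
  shows "(\<lambda>i. x i - 2 * f x * v i) \<in> carrier ell2"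
  using assms by (simp add: summable_square_norm_diff summable_square_norm_smult)

lemma ran_reflection:
  assumes "v \<in> carrier ell2"
  shows "ran (reflection f v) \<subseteq> carrier ell2"
proof
  fix z assume "z \<in> ran (reflection f v)"
  then obtain x where x: "reflection f v x = Some z"
    by (auto simp: ran_def)
  then have "x \<in> carrier ell2"
    using dom_reflection by blast
  with x reflection_closed[OF this assms, of f] show "z \<in> carrier ell2"
    by (metis option.inject reflection_apply)
qed

lemma linear_operator_reflection:
  assumes add: "\<And>x y. f (x + y) = f x + f y" and scale: "\<And>a x. f (\<lambda>i. a * x i) = a * f x"
    and v: "v \<in> carrier ell2"
  shows "linear_operator ell2 (reflection f v)"
proof (intro linear_operator.intro linear_operator_axioms.intro complex_hilbert_space_ell2)
  show "submodule (dom (reflection f v)) complex_field ell2"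
    unfolding dom_reflection by (rule module.carrier_is_submodule[OF module_ell2])
  show "ran (reflection f v) \<subseteq> carrier ell2"
    using v by (rule ran_reflection)
next
  fix x y assume "x \<in> dom (reflection f v)" "y \<in> dom (reflection f v)"
  then show "the (reflection f v (x \<oplus>\<^bsub>ell2\<^esub> y)) =
      the (reflection f v x) \<oplus>\<^bsub>ell2\<^esub> the (reflection f v y)"
    by (simp add: summable_square_norm_add add fun_eq_iff algebra_simps)
next
  fix a x assume "x \<in> dom (reflection f v)"
  then show "the (reflection f v (a \<odot>\<^bsub>ell2\<^esub> x)) = a \<odot>\<^bsub>ell2\<^esub> the (reflection f v x)"
    by (simp add: summable_square_norm_smult scale fun_eq_iff algebra_simps)
qed

text \<open>Since \<open>f (x - 2 f(x) v) = f x - 2 f(x) = - f x\<close>, the second reflection adds back what the first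
  one subtracted.\<close>

lemma reflection_involution:
  assumes add: "\<And>x y. f (x + y) = f x + f y" and scale: "\<And>a x. f (\<lambda>i. a * x i) = a * f x"
    and v: "v \<in> carrier ell2" "f v = 1"
  shows "reflection f v \<circ>\<^sub>m reflection f v = identity_operator ell2"
proof
  fix x
  show "(reflection f v \<circ>\<^sub>m reflection f v) x = identity_operator ell2 x"
  proof (cases "x \<in> carrier ell2")
    case True
    have "(\<lambda>i. x i - 2 * f x * v i) = x + (\<lambda>i. (- 2 * f x) * v i)"
      by (simp add: fun_eq_iff)
    then have "f (\<lambda>i. x i - 2 * f x * v i) = - f x"
      using v(2) by (simp only: add scale) simp
    then show ?thesis
      using True reflection_closed[OF True v(1), of f]
      by (simp add: map_comp_def identity_operator_def del: ell2_simps(1))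
  next
    case False
    then show ?thesis
      by (simp add: map_comp_def identity_operator_def reflection_def del: ell2_simps(1))
  qed
qed

text \<open>The witnessing limit is that of \<open>u\<^sub>k - 2 f(u\<^sub>k) v = u\<^sub>k - 2 v\<close>, namely \<open>- 2 v\<close>.\<close>

lemma not_closable_reflection:
  assumes v: "v \<in> carrier ell2" "v \<noteq> 0"
    and u: "range u \<subseteq> carrier ell2" "hconverges ell2 u \<zero>\<^bsub>ell2\<^esub>" "\<And>k. f (u k) = 1"
  shows "\<not> closable ell2 (reflection f v)"
proof
  assume clos: "closable ell2 (reflection f v)"
  define y where "y = (\<lambda>i. - 2 * v i)"
  have y: "y \<in> carrier ell2"
    using v(1) unfolding y_def ell2_simps by (rule summable_square_norm_smult)
  have uc: "u k \<in> carrier ell2" for k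
    using u(1) by blast
  have Tu: "the (reflection f v (u k)) = u k + y" for k
    using uc[of k] u(3) by (simp add: y_def fun_eq_iff)
  have "u k + y \<ominus>\<^bsub>ell2\<^esub> y = u k \<ominus>\<^bsub>ell2\<^esub> \<zero>\<^bsub>ell2\<^esub>" for k
    using uc[of k] y by (simp add: summable_square_norm_add)
  then have "hconverges ell2 (\<lambda>k. the (reflection f v (u k))) y"
    using u(2) by (simp add: Tu hconverges_def)
  then have "y = 0"
    using clos y u by (simp add: closable_def)
  then have "v = 0"
    by (simp add: y_def fun_eq_iff)
  with v(2) show False ..
qed

theorem proposition1p31:
  shows "\<exists>(H :: (nat \<Rightarrow> complex) cinner_space) T.
    complex_hilbert_space H \<and> linear_operator H T \<and> everywhere_defined H T \<and>
    \<not> closable H T \<and> \<not> bounded_operator H T \<and> T \<circ>\<^sub>m T = identity_operator H"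
proof -
  obtain f :: "(nat \<Rightarrow> complex) \<Rightarrow> complex"
    where add: "\<And>x y. f (x + y) = f x + f y" and scale: "\<And>a x. f (\<lambda>i. a * x i) = a * f x"
      and unit: "\<And>n. f (unit_seq n) = of_nat (Suc n)"
    using exists_functional_on_unit_seqs[of "\<lambda>n. of_nat (Suc n)"] by blast
  define v where "v = unit_seq 0"
  define u where "u k = (\<lambda>i. inverse (of_nat (Suc k)) * unit_seq k i)" for k
  have v: "v \<in> carrier ell2" "f v = 1"
    using unit_seq_in_ell2 unit[of 0] by (simp_all add: v_def)
  have "v \<noteq> 0"
    by (auto simp: v_def unit_seq_def fun_eq_iff)
  have uc: "u k \<in> carrier ell2" for k
    using unit_seq_in_ell2[of k] unfolding u_def ell2_simps by (rule summable_square_norm_smult)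
  have "hnorm ell2 (u k) = inverse (real (Suc k))" for k
    by (simp only: u_def hnorm_scaled_unit_seq norm_inverse norm_of_nat)
  then have u0: "hconverges ell2 u \<zero>\<^bsub>ell2\<^esub>"
    using uc LIMSEQ_inverse_real_of_nat by (simp add: hconverges_def)
  have fu: "f (u k) = 1" for k
    unfolding u_def scale unit by (rule left_inverse) (rule of_nat_neq_0)
  have "\<not> closable ell2 (reflection f v)"
    using uc by (intro not_closable_reflection[of v u] v \<open>v \<noteq> 0\<close> u0 fu) auto
  moreover have "\<not> bounded_operator ell2 (reflection f v)"
    using calculation bounded_imp_closable_ell2 ran_reflection[OF v(1)]
    by (metis dom_reflection order_refl)
  moreover have "linear_operator ell2 (reflection f v)"
    using add scale v(1) by (rule linear_operator_reflection)
  moreover have "reflection f v \<circ>\<^sub>m reflection f v = identity_operator ell2"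
    using add scale v by (rule reflection_involution)
  ultimately show ?thesis
    using complex_hilbert_space_ell2
    by (intro exI[of _ ell2] exI[of _ "reflection f v"]) (simp add: everywhere_defined_def)
qed

end
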